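(* Let $(H,\circ)$ be an LA-semihypergroup with pure left identity $e$. If $H$ is left invertible, then $H$ is intra-regular. Likewise, if $H$ is right invertible, then $H$ is intra-regular.
   Context: A hyperoperation on a non-empty set $H$ is a map $\circ: H\times H\to \mathcal{P}(H)\setminus\{\emptyset\}$. For non-empty $A,B\subseteq H$, $A\circ B=\bigcup_{a\in A,\,b\in B}a\circ b$, and singletons are identified with their elements ($a\circ B=\{a\}\circ B$, etc.). $(H,\circ)$ is an LA-semihypergroup if $(x\circ y)\circ z=(z\circ y)\circ x$ for all $x,y,z\in H$. An element $e\in H$ is a left identity if $a\in e\circ a$ for all $a\in H$, and a pure left identity if $e\circ a=\{a\}$ for all $a\in H$. An element $a$ of an LA-semihypergroup with left identity $e$ is left (resp. right) invertible if there exists $x\in H$ with $e\in x\circ a$ (resp. $e\in a\circ x$); $H$ is left (resp. right) invertible if every element of $H$ is left (resp. right) invertible. Write $a^2=a\circ a$. $H$ is intra-regular if for every $a\in H$ there exist $x,y\in H$ with $a\in (x\circ a^2)\circ y$. *)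

theory Defs
  imports Main
begin

definition hyperoperation :: "'a set \<Rightarrow> ('a \<Rightarrow> 'a \<Rightarrow> 'a set) \<Rightarrow> bool" where
  "hyperoperation H f \<longleftrightarrow> H \<noteq> {} \<and> (\<forall>x\<in>H. \<forall>y\<in>H. f x y \<in> Pow H - {{}})"

definition set_hop :: "('a \<Rightarrow> 'a \<Rightarrow> 'a set) \<Rightarrow> 'a set \<Rightarrow> 'a set \<Rightarrow> 'a set" where
  "set_hop f A B = (\<Union>a\<in>A. \<Union>b\<in>B. f a b)"

definition LA_semihypergroup :: "'a set \<Rightarrow> ('a \<Rightarrow> 'a \<Rightarrow> 'a set) \<Rightarrow> bool" where
  "LA_semihypergroup H f \<longleftrightarrow> hyperoperation H f \<and>
     (\<forall>x\<in>H. \<forall>y\<in>H. \<forall>z\<in>H. set_hop f (f x y) {z} = set_hop f (f z y) {x})"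

definition pure_left_identity :: "'a set \<Rightarrow> ('a \<Rightarrow> 'a \<Rightarrow> 'a set) \<Rightarrow> 'a \<Rightarrow> bool" where
  "pure_left_identity H f e \<longleftrightarrow> e \<in> H \<and> (\<forall>a\<in>H. f e a = {a})"

text \<open>Invertibility is relative to a chosen left identity \<open>e\<close>.\<close>

definition left_invertible_elem ::
    "'a set \<Rightarrow> ('a \<Rightarrow> 'a \<Rightarrow> 'a set) \<Rightarrow> 'a \<Rightarrow> 'a \<Rightarrow> bool" where
  "left_invertible_elem H f e a \<longleftrightarrow> (\<exists>x\<in>H. e \<in> f x a)"

definition right_invertible_elem ::
    "'a set \<Rightarrow> ('a \<Rightarrow> 'a \<Rightarrow> 'a set) \<Rightarrow> 'a \<Rightarrow> 'a \<Rightarrow> bool" where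
  "right_invertible_elem H f e a \<longleftrightarrow> (\<exists>x\<in>H. e \<in> f a x)"

definition left_invertible :: "'a set \<Rightarrow> ('a \<Rightarrow> 'a \<Rightarrow> 'a set) \<Rightarrow> 'a \<Rightarrow> bool" where
  "left_invertible H f e \<longleftrightarrow> (\<forall>a\<in>H. left_invertible_elem H f e a)"

definition right_invertible :: "'a set \<Rightarrow> ('a \<Rightarrow> 'a \<Rightarrow> 'a set) \<Rightarrow> 'a \<Rightarrow> bool" where
  "right_invertible H f e \<longleftrightarrow> (\<forall>a\<in>H. right_invertible_elem H f e a)"

definition intra_regular :: "'a set \<Rightarrow> ('a \<Rightarrow> 'a \<Rightarrow> 'a set) \<Rightarrow> bool" where
  "intra_regular H f \<longleftrightarrow>
     (\<forall>a\<in>H. \<exists>x\<in>H. \<exists>y\<in>H. a \<in> set_hop f (set_hop f {x} (f a a)) {y})"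

end

(* If e \<in> x \<circ> a, then a \<in> e \<circ> a \<subseteq> (x \<circ> a) \<circ> a = a^2 \<circ> x = (e \<circ> a^2) \<circ> x.
   A right inverse x of a is also a left inverse, since e \<in> e \<circ> e \<subseteq> (a \<circ> x) \<circ> e = (e \<circ> x) \<circ> a = x \<circ> a. *)
theory Submission
  imports Defs
begin

lemma set_hop_singletons: "set_hop f {x} {y} = f x y"
  by (simp add: set_hop_def)

lemma set_hop_memI: "c \<in> A \<Longrightarrow> b \<in> B \<Longrightarrow> d \<in> f c b \<Longrightarrow> d \<in> set_hop f A B"
  by (auto simp: set_hop_def)

lemma set_hop_closed:
  assumes "LA_semihypergroup H f" "A \<subseteq> H" "B \<subseteq> H"
  shows "set_hop f A B \<subseteq> H"
  using assms unfolding LA_semihypergroup_def hyperoperation_def set_hop_def by blast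

lemma left_invertive_law:
  assumes "LA_semihypergroup H f" "x \<in> H" "y \<in> H" "z \<in> H"
  shows "set_hop f (f x y) {z} = set_hop f (f z y) {x}"
  using assms by (simp add: LA_semihypergroup_def)

text \<open>Purity gives equality here; a plain left identity would only give \<open>A\<close> as a
  subset of the product.\<close>

lemma set_hop_pure_left_identity:
  assumes "pure_left_identity H f e" "A \<subseteq> H"
  shows "set_hop f {e} A = A"
  using assms by (auto simp: pure_left_identity_def set_hop_def)

lemma right_invertible_imp_left_invertible:
  assumes "LA_semihypergroup H f" "pure_left_identity H f e" "right_invertible H f e"
  shows "left_invertible H f e"
  unfolding left_invertible_def left_invertible_elem_def
proof
  fix a assume a: "a \<in> H"
  with assms(3) obtain x where x: "x \<in> H" "e \<in> f a x"
    by (auto simp: right_invertible_def right_invertible_elem_def)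
  have e: "e \<in> H" "f e e = {e}" "f e x = {x}"
    using assms(2) x(1) by (auto simp: pure_left_identity_def)
  have "e \<in> set_hop f (f a x) {e}"
    by (rule set_hop_memI[OF x(2), of e]) (simp_all add: e)
  \<comment> \<open>The law exchanges the outer factors \<open>a\<close> and \<open>e\<close>;
    purity then collapses \<open>f e x\<close> to \<open>{x}\<close>.\<close>
  also have "\<dots> = f x a"
    using left_invertive_law[OF assms(1) a x(1) e(1)] by (simp add: e set_hop_singletons)
  finally show "\<exists>x\<in>H. e \<in> f x a"
    using x(1) by blast
qed

lemma left_invertible_imp_intra_regular:
  assumes "LA_semihypergroup H f" "pure_left_identity H f e" "left_invertible H f e"
  shows "intra_regular H f"
  unfolding intra_regular_def
proof
  fix a assume a: "a \<in> H"
  with assms(3) obtain x where x: "x \<in> H" "e \<in> f x a"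
    by (auto simp: left_invertible_def left_invertible_elem_def)
  have e: "e \<in> H" "f e a = {a}"
    using assms(2) a by (auto simp: pure_left_identity_def)
  \<comment> \<open>Needed because \<open>e\<close> is known to act as an identity only on elements
    of \<open>H\<close>.\<close>
  have "f a a \<subseteq> H"
    using set_hop_closed[OF assms(1), of "{a}" "{a}"] a by (simp add: set_hop_singletons)
  then have square: "set_hop f {e} (f a a) = f a a"
    by (rule set_hop_pure_left_identity[OF assms(2)])
  have "a \<in> set_hop f (f x a) {a}"
    by (rule set_hop_memI[OF x(2), of a]) (simp_all add: e)
  \<comment> \<open>The law exchanges \<open>x\<close> with the last \<open>a\<close>, which forms
    the square; \<open>square\<close> read backwards supplies the left factor required by
    intra-regularity.\<close>
  also have "\<dots> = set_hop f (set_hop f {e} (f a a)) {x}"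
    using left_invertive_law[OF assms(1) x(1) a a] by (simp add: square)
  \<comment> \<open>The left witness is \<open>e\<close> for every \<open>a\<close>; the right
    witness is the left inverse \<open>x\<close> of \<open>a\<close>.\<close>
  finally show "\<exists>x\<in>H. \<exists>y\<in>H. a \<in> set_hop f (set_hop f {x} (f a a)) {y}"
    using e(1) x(1) by blast
qed

theorem theorem2:
  fixes H :: "'a set" and f :: "'a \<Rightarrow> 'a \<Rightarrow> 'a set" and e :: 'a
  assumes "LA_semihypergroup H f"
    and "pure_left_identity H f e"
  shows "(left_invertible H f e \<longrightarrow> intra_regular H f) \<and>
         (right_invertible H f e \<longrightarrow> intra_regular H f)"
  using left_invertible_imp_intra_regular[OF assms]
    right_invertible_imp_left_invertible[OF assms] by blast

end
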